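(* Let $\mathfrak{g}$ be a Lie algebra over a field $K$ of characteristic zero, endowed with an invariant symmetric bilinear form $B:\mathfrak{g}\times\mathfrak{g}\to K$. Suppose that $\mathfrak{g}$ admits a Lie algebra grading $\mathfrak{g}=\bigoplus_{\alpha\in A}\mathfrak{g}_\alpha$ in a torsion-free abelian group $A$ for which $B$ is homogeneous of nonzero degree. Then the alternating 3-form $J_B(x,y,z)=B(x,[y,z])$ is exact.
   Context: Invariant means $B([x,y],z)=B(x,[y,z])$ for all $x,y,z\in\mathfrak{g}$; then $J_B$ (denoted $\eta^*(B)$ in the paper) is alternating. A Lie algebra grading in $A$ satisfies $[\mathfrak{g}_\alpha,\mathfrak{g}_\beta]\subset\mathfrak{g}_{\alpha+\beta}$. $B$ is homogeneous of degree $\delta\in A$ if $B(\mathfrak{g}_\alpha,\mathfrak{g}_\beta)=0$ whenever $\alpha+\beta+\delta\neq 0$. Exact means that $J_B$ is a coboundary in the Chevalley–Eilenberg cochain complex with trivial coefficients $K$, i.e. there is an alternating bilinear form $\omega$ on $\mathfrak{g}$ with $J_B(x,y,z)=\omega(x,[y,z])+\omega(y,[z,x])+\omega(z,[x,y])$ for all $x,y,z\in\mathfrak{g}$. *)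

theory Defs
  imports Complex_Main
begin

section \<open>Lie algebras, of arbitrary dimension\<close>

definition bilinear_map ::
  "('k::field \<Rightarrow> 'v::ab_group_add \<Rightarrow> 'v) \<Rightarrow> ('k \<Rightarrow> 'w::ab_group_add \<Rightarrow> 'w) \<Rightarrow> ('v \<Rightarrow> 'v \<Rightarrow> 'w) \<Rightarrow> bool"
  where "bilinear_map s t f \<longleftrightarrow>
    (\<forall>x. Vector_Spaces.linear s t (\<lambda>y. f x y)) \<and> (\<forall>y. Vector_Spaces.linear s t (\<lambda>x. f x y))"

locale lie_algebra = vector_space scale
  for scale :: "'k::field \<Rightarrow> 'g::ab_group_add \<Rightarrow> 'g" +
  fixes bracket :: "'g \<Rightarrow> 'g \<Rightarrow> 'g"
  assumes bilinear_bracket: "bilinear_map scale scale bracket"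
    and bracket_self: "bracket x x = 0"
    and jacobi: "bracket x (bracket y z) + bracket y (bracket z x) + bracket z (bracket x y) = 0"

section \<open>Bilinear forms and the associated 3-form\<close>

definition bilinear_form ::
  "('k::field \<Rightarrow> 'g::ab_group_add \<Rightarrow> 'g) \<Rightarrow> ('g \<Rightarrow> 'g \<Rightarrow> 'k) \<Rightarrow> bool"
  where "bilinear_form scale B \<longleftrightarrow> bilinear_map scale (*) B"

definition symmetric_form :: "('g \<Rightarrow> 'g \<Rightarrow> 'k) \<Rightarrow> bool"
  where "symmetric_form B \<longleftrightarrow> (\<forall>x y. B x y = B y x)"

definition alternating_form :: "('g \<Rightarrow> 'g \<Rightarrow> 'k::zero) \<Rightarrow> bool"
  where "alternating_form \<omega> \<longleftrightarrow> (\<forall>x. \<omega> x x = 0)"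

definition invariant_form :: "('g \<Rightarrow> 'g \<Rightarrow> 'g) \<Rightarrow> ('g \<Rightarrow> 'g \<Rightarrow> 'k) \<Rightarrow> bool"
  where "invariant_form bracket B \<longleftrightarrow> (\<forall>x y z. B (bracket x y) z = B x (bracket y z))"

definition J_form :: "('g \<Rightarrow> 'g \<Rightarrow> 'g) \<Rightarrow> ('g \<Rightarrow> 'g \<Rightarrow> 'k) \<Rightarrow> 'g \<Rightarrow> 'g \<Rightarrow> 'g \<Rightarrow> 'k"
  where "J_form bracket B x y z = B x (bracket y z)"

text \<open>The Chevalley--Eilenberg differential (trivial coefficients) of a 2-cochain. For alternating
  \<open>\<omega>\<close> this is the usual \<open>- \<omega>([x,y],z) + \<omega>([x,z],y) - \<omega>([y,z],x)\<close>.\<close>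

definition ce_d2 ::
  "('g \<Rightarrow> 'g \<Rightarrow> 'g) \<Rightarrow> ('g \<Rightarrow> 'g \<Rightarrow> 'k::plus) \<Rightarrow> 'g \<Rightarrow> 'g \<Rightarrow> 'g \<Rightarrow> 'k"
  where "ce_d2 bracket \<omega> x y z =
    \<omega> x (bracket y z) + \<omega> y (bracket z x) + \<omega> z (bracket x y)"

definition exact_3form ::
  "('k::field \<Rightarrow> 'g::ab_group_add \<Rightarrow> 'g) \<Rightarrow> ('g \<Rightarrow> 'g \<Rightarrow> 'g) \<Rightarrow> ('g \<Rightarrow> 'g \<Rightarrow> 'g \<Rightarrow> 'k) \<Rightarrow> bool"
  where "exact_3form scale bracket J \<longleftrightarrow>
    (\<exists>\<omega>. bilinear_form scale \<omega> \<and> alternating_form \<omega> \<and> (\<forall>x y z. J x y z = ce_d2 bracket \<omega> x y z))"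

section \<open>Gradings in an abelian group\<close>

text \<open>The sum \<open>\<Sum>i<n. a\<close> is the multiple \<open>n \<cdot> a\<close>.\<close>

definition torsion_free_group :: "'a::ab_group_add itself \<Rightarrow> bool"
  where "torsion_free_group _ \<longleftrightarrow> (\<forall>(n::nat) (a::'a). n > 0 \<longrightarrow> (\<Sum>i<n. a) = 0 \<longrightarrow> a = 0)"

text \<open>Internal direct sum: the whole space is the direct sum of the subspaces \<open>V \<alpha>\<close>, i.e.\ each
  vector is the sum of exactly one finitely supported family \<open>c\<close> with \<open>c \<alpha> \<in> V \<alpha>\<close>.\<close>

definition direct_sum_decomposition ::
  "('k::field \<Rightarrow> 'g::ab_group_add \<Rightarrow> 'g) \<Rightarrow> ('a \<Rightarrow> 'g set) \<Rightarrow> bool"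
  where "direct_sum_decomposition scale V \<longleftrightarrow>
    (\<forall>\<alpha>. module.subspace scale (V \<alpha>)) \<and>
    (\<forall>x. \<exists>!c. (\<forall>\<alpha>. c \<alpha> \<in> V \<alpha>) \<and> finite {\<alpha>. c \<alpha> \<noteq> 0} \<and> x = (\<Sum>\<alpha> | c \<alpha> \<noteq> 0. c \<alpha>))"

definition lie_grading ::
  "('k::field \<Rightarrow> 'g::ab_group_add \<Rightarrow> 'g) \<Rightarrow> ('g \<Rightarrow> 'g \<Rightarrow> 'g) \<Rightarrow> ('a::ab_group_add \<Rightarrow> 'g set) \<Rightarrow> bool"
  where "lie_grading scale bracket V \<longleftrightarrow>
    direct_sum_decomposition scale V \<and>
    (\<forall>\<alpha> \<beta>. \<forall>x\<in>V \<alpha>. \<forall>y\<in>V \<beta>. bracket x y \<in> V (\<alpha> + \<beta>))"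

definition homogeneous_form ::
  "('a::ab_group_add \<Rightarrow> 'g set) \<Rightarrow> ('g \<Rightarrow> 'g \<Rightarrow> 'k::zero) \<Rightarrow> 'a \<Rightarrow> bool"
  where "homogeneous_form V B \<delta> \<longleftrightarrow>
    (\<forall>\<alpha> \<beta>. \<alpha> + \<beta> + \<delta> \<noteq> 0 \<longrightarrow> (\<forall>x\<in>V \<alpha>. \<forall>y\<in>V \<beta>. B x y = 0))"

end

theory Submission
  imports Defs
begin

text \<open>Choose an additive map \<open>\<phi> : A \<rightarrow> K\<close> with \<open>\<phi> \<delta> = 1\<close>, and let \<open>D\<close> be the derivation
  acting on \<open>V \<alpha>\<close> as multiplication by \<open>\<phi> \<alpha>\<close>. Homogeneity of \<open>B\<close> gives
  \<open>B (D x) y + B x (D y) = l * B x y\<close> with \<open>l = - 1\<close>, so \<open>D\<close> also rescales the 3-form by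
  \<open>l\<close>; it follows that \<open>\<omega> x y = (B x (D y) - B (D x) y) / l\<close> is a primitive.\<close>

section \<open>Exactness from a derivation that rescales the form\<close>

lemma bilinear_map_iff:
  "bilinear_map s t f \<longleftrightarrow> vector_space s \<and> vector_space t \<and>
    (\<forall>x y z. f (x + y) z = f x z + f y z) \<and> (\<forall>x y z. f x (y + z) = f x y + f x z) \<and>
    (\<forall>c x y. f (s c x) y = t c (f x y)) \<and> (\<forall>c x y. f x (s c y) = t c (f x y))"
  unfolding bilinear_map_def Vector_Spaces.linear_iff by blast

text \<open>Write \<open>J\<close> for the 3-form. Rescaling turns
  \<open>\<omega> x (bracket y z)\<close> into \<open>J x y z - (2 / l) * J (D x) y z\<close>. In
  the cyclic sum the first terms give \<open>3 * J x y z\<close>; since \<open>D\<close> is a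
  derivation, the second terms add up to \<open>2 * J x y z\<close>, leaving exactly one copy of
  \<open>J\<close>.\<close>

lemma exact_3form_of_derivation:
  assumes "lie_algebra scale bracket" and "bilinear_form scale B" and "symmetric_form B"
    and "invariant_form bracket B"
    and "Vector_Spaces.linear scale scale D"
    and derivation: "\<And>x y. D (bracket x y) = bracket (D x) y + bracket x (D y)"
    and rescale: "\<And>x y. B (D x) y + B x (D y) = l * B x y"
    and "l \<noteq> 0"
  shows "exact_3form scale bracket (J_form bracket B)"
proof -
  have B: "B (x + y) z = B x z + B y z" "B x (y + z) = B x y + B x z"
    "B (scale c x) y = c * B x y" "B x (scale c y) = c * B x y" for x y z c
    using assms(2) unfolding bilinear_form_def bilinear_map_iff by auto
  have vs: "vector_space scale" "vector_space ((*) :: 'a \<Rightarrow> 'a \<Rightarrow> 'a)"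
    using assms(2) unfolding bilinear_form_def bilinear_map_iff by auto
  have sym: "B x y = B y x" for x y
    using assms(3) unfolding symmetric_form_def by blast
  have inv: "B (bracket x y) z = B x (bracket y z)" for x y z
    using assms(4) unfolding invariant_form_def by blast
  have D: "D (x + y) = D x + D y" "D (scale c x) = scale c (D x)" for x y c
    using assms(5) unfolding Vector_Spaces.linear_iff by auto
  have cyc: "B y (bracket z x) = B x (bracket y z)" for x y z
    by (metis inv sym)
  define \<omega> where "\<omega> x y = (B x (D y) - B (D x) y) / l" for x y
  have "bilinear_form scale \<omega>"
    unfolding bilinear_form_def bilinear_map_iff \<omega>_def
    using vs \<open>l \<noteq> 0\<close> by (auto simp: B D field_simps)
  moreover have "alternating_form \<omega>"
    unfolding alternating_form_def \<omega>_def by (simp add: sym)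
  moreover have "J_form bracket B x y z = ce_d2 bracket \<omega> x y z" for x y z
  proof -
    define J where "J x y z = B x (bracket y z)" for x y z
    have \<omega>J: "\<omega> x (bracket y z) = (l * J x y z - 2 * J (D x) y z) / l" for x y z
      using rescale[of x "bracket y z"] unfolding \<omega>_def J_def
      by (simp add: algebra_simps eq_diff_eq)
    have DJ: "J (D x) y z + J x (D y) z + J x y (D z) = l * J x y z"
      using rescale[of x "bracket y z"] unfolding derivation J_def by (simp add: B add.assoc)
    have cycJ: "J y z x = J x y z" for x y z
      unfolding J_def by (rule cyc)
    \<comment> \<open>Cyclic symmetry puts the three summands of \<open>ce_d2\<close> into the shape
      of the left side of \<open>DJ\<close>.\<close>
    have "J (D y) z x = J x (D y) z" "J (D z) x y = J x y (D z)" "J y z x = J x y z" "J z x y = J x y z"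
      using cycJ by metis+
    then have "ce_d2 bracket \<omega> x y z
      = (3 * (l * J x y z) - 2 * (J (D x) y z + J x (D y) z + J x y (D z))) / l"
      unfolding ce_d2_def \<omega>J by (simp add: add_divide_distrib diff_divide_distrib algebra_simps)
    also have "\<dots> = J x y z"
      unfolding DJ using \<open>l \<noteq> 0\<close> by (simp add: field_simps)
    finally show ?thesis
      unfolding J_def J_form_def by simp
  qed
  ultimately show ?thesis
    unfolding exact_3form_def by blast
qed

section \<open>Integer multiples and additive maps on torsion-free groups\<close>

text \<open>Since \<open>nat\<close> sends negative integers to 0, at most one of the two sums is
  nonempty. They have the form used in \<open>torsion_free_group\<close>, so that hypothesis applies
  directly.\<close>

definition int_mult :: "int \<Rightarrow> 'a::ab_group_add \<Rightarrow> 'a"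
  where "int_mult k a = (\<Sum>i<nat k. a) - (\<Sum>i<nat (- k). a)"

lemma int_mult_succ: "int_mult (k + 1) a = int_mult k a + a"
proof (cases "k \<ge> 0")
  case True
  then have "nat (k + 1) = Suc (nat k)" by simp
  with True show ?thesis unfolding int_mult_def by simp
next
  case False
  then have "nat (- k) = Suc (nat (- (k + 1)))" by simp
  with False show ?thesis unfolding int_mult_def by simp
qed

lemma int_mult_add: "int_mult (k + m) a = int_mult k a + int_mult m a"
proof (induction m rule: int_induct[of _ 0])
  case base
  then show ?case by (simp add: int_mult_def)
next
  case (step1 i)
  then show ?case using int_mult_succ[of "k + i" a] int_mult_succ[of i a] by (simp add: ac_simps)
next
  case (step2 i)
  then show ?case using int_mult_succ[of "k + (i - 1)" a] int_mult_succ[of "i - 1" a]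
    by (simp add: algebra_simps)
qed

lemma int_mult_mult: "int_mult k (int_mult m a) = int_mult (k * m) a"
proof (induction k rule: int_induct[of _ 0])
  case base
  then show ?case by (simp add: int_mult_def)
next
  case (step1 i)
  then show ?case using int_mult_succ[of i "int_mult m a"] by (simp add: int_mult_add distrib_right)
next
  case (step2 i)
  have "int_mult i (int_mult m a) = int_mult (i - 1) (int_mult m a) + int_mult m a"
    using int_mult_succ[of "i - 1"] by simp
  moreover have "int_mult (i * m) a = int_mult ((i - 1) * m) a + int_mult m a"
    using int_mult_add[of "(i - 1) * m" m a] by (simp add: algebra_simps)
  ultimately show ?case using step2 by simp
qed

text \<open>As a module over the integers, an abelian group has its subgroups as
  \<open>int_mult.subspace\<close> and generated subgroups as \<open>int_mult.span\<close>.\<close>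

interpretation int_mult: module int_mult
proof
  show "int_mult k (x + y) = int_mult k x + int_mult k y" for k and x y :: 'a
    unfolding int_mult_def by (simp only: sum.distrib) simp
  show "int_mult 1 x = x" for x :: 'a
    unfolding int_mult_def by simp
qed (simp_all add: int_mult_add int_mult_mult)

lemma torsion_free_int_mult_eq_0:
  assumes "torsion_free_group TYPE('a::ab_group_add)" and "int_mult k (a::'a) = 0" and "a \<noteq> 0"
  shows "k = 0"
proof (rule ccontr)
  assume "k \<noteq> 0"
  have "\<bar>k\<bar> = k \<or> \<bar>k\<bar> = - k" by linarith
  then have "int_mult \<bar>k\<bar> a = 0"
    using assms(2) int_mult.scale_minus_left[of k a] by auto
  then have "(\<Sum>i<nat \<bar>k\<bar>. a) = 0"
    unfolding int_mult_def by simp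
  with \<open>k \<noteq> 0\<close> assms(1,3) show False
    unfolding torsion_free_group_def by (metis zero_less_abs_iff zero_less_nat_eq)
qed

text \<open>For a subgroup \<open>N\<close> maximal among those without nonzero multiples of \<open>\<delta>\<close>, every \<open>a\<close>
  satisfies \<open>m a \<equiv> k \<delta>\<close> modulo \<open>N\<close> with \<open>m \<noteq> 0\<close>, and the ratio \<open>k / m\<close> is determined by \<open>a\<close>.\<close>

lemma torsion_free_additive_map:
  fixes \<delta> :: "'a::ab_group_add"
  assumes tf: "torsion_free_group TYPE('a)" and "\<delta> \<noteq> 0"
  obtains \<phi> :: "'a \<Rightarrow> 'k::field_char_0"
  where "\<And>a b. \<phi> (a + b) = \<phi> a + \<phi> b" and "\<phi> \<delta> = 1"
proof -
  define F where "F = {N. int_mult.subspace N \<and> (\<forall>k. int_mult k \<delta> \<in> N \<longrightarrow> k = 0)}"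
  \<comment> \<open>Torsion-freeness enters here: it gives Zorn's lemma a nonempty family.\<close>
  have "{0} \<in> F"
    using torsion_free_int_mult_eq_0[OF tf] \<open>\<delta> \<noteq> 0\<close> unfolding F_def by auto
  then have "F \<noteq> {}" by blast
  moreover have "\<Union>C \<in> F" if "C \<noteq> {}" "subset.chain F C" for C
  proof -
    have C: "C \<subseteq> F" "\<And>X Y. X \<in> C \<Longrightarrow> Y \<in> C \<Longrightarrow> X \<subseteq> Y \<or> Y \<subseteq> X"
      using that(2) unfolding subset_chain_def by auto
    have sub: "int_mult.subspace X" if "X \<in> C" for X
      using C(1) that unfolding F_def by blast
    have "int_mult.subspace (\<Union>C)"
    proof (rule int_mult.subspaceI)
      show "0 \<in> \<Union>C"
        using \<open>C \<noteq> {}\<close> sub int_mult.subspace_0 by blast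
      show "x + y \<in> \<Union>C" if xy: "x \<in> \<Union>C" "y \<in> \<Union>C" for x y
      proof -
        obtain X Y where XY: "X \<in> C" "x \<in> X" "Y \<in> C" "y \<in> Y" using xy by blast
        then obtain Z where "Z \<in> C" "x \<in> Z" "y \<in> Z" using C(2)[of X Y] by blast
        then show ?thesis using sub int_mult.subspace_add by blast
      qed
      show "int_mult c x \<in> \<Union>C" if "x \<in> \<Union>C" for c x
        using that sub int_mult.subspace_scale by blast
    qed
    then show ?thesis using C(1) unfolding F_def by blast
  qed
  ultimately obtain N where N: "N \<in> F" and max: "\<And>X. X \<in> F \<Longrightarrow> N \<subseteq> X \<Longrightarrow> X = N"
    using subset_Zorn_nonempty[of F] by blast
  have subN: "int_mult.subspace N" and free: "\<And>k. int_mult k \<delta> \<in> N \<Longrightarrow> k = 0"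
    using N unfolding F_def by auto
  define R where "R a m k \<longleftrightarrow> m \<noteq> 0 \<and> int_mult m a - int_mult k \<delta> \<in> N" for a m k
  have ex: "\<exists>m k. R a m k" for a
  proof (cases "a \<in> N")
    case True
    then have "R a 1 0" unfolding R_def by simp
    then show ?thesis by blast
  next
    case False
    let ?M = "int_mult.span (insert a N)"
    have "a \<in> ?M" "N \<subseteq> ?M"
      using int_mult.span_superset[of "insert a N"] by blast+
    \<comment> \<open>By maximality, adjoining \<open>a\<close> to \<open>N\<close> must capture a
      nonzero multiple of \<open>\<delta>\<close>. Its \<open>a\<close>-coefficient \<open>m\<close>
      is nonzero, as otherwise that multiple would already lie in \<open>N\<close>.\<close>
    with False max have "?M \<notin> F" by blast
    then obtain k where k: "int_mult k \<delta> \<in> ?M" "k \<noteq> 0"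
      unfolding F_def by auto
    then obtain m where m: "int_mult k \<delta> - int_mult m a \<in> N"
      using subN unfolding int_mult.span_breakdown_eq by (metis int_mult.span_eq_iff)
    have "m \<noteq> 0" using m k(2) free by auto
    moreover have "int_mult m a - int_mult k \<delta> \<in> N"
      using int_mult.subspace_neg[OF subN m] by simp
    ultimately show ?thesis unfolding R_def by blast
  qed
  have unique: "m * k' = m' * k" if R: "R a m k" "R a m' k'" for a m k m' k'
  proof -
    \<comment> \<open>Cross-multiplying cancels \<open>a\<close> and leaves a multiple of
      \<open>\<delta>\<close> in \<open>N\<close>, whose coefficient must vanish.\<close>
    have "int_mult m' (int_mult m a - int_mult k \<delta>) - int_mult m (int_mult m' a - int_mult k' \<delta>) \<in> N"
      using R subN unfolding R_def
      by (metis int_mult.subspace_diff int_mult.subspace_scale)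
    also have "int_mult m' (int_mult m a - int_mult k \<delta>) - int_mult m (int_mult m' a - int_mult k' \<delta>)
      = int_mult (m * k' - m' * k) \<delta>"
      by (simp add: int_mult.scale_right_diff_distrib int_mult.scale_left_diff_distrib mult.commute)
    finally show ?thesis using free by fastforce
  qed
  \<comment> \<open>Characteristic zero keeps the denominators nonzero in the field, so
    \<open>unique\<close> becomes an equality of fractions.\<close>
  have "\<exists>\<phi>. \<forall>a m k. R a m k \<longrightarrow> \<phi> a = (of_int k / of_int m :: 'k)"
  proof (intro choice allI)
    fix a
    obtain m k where mk: "R a m k" using ex by blast
    have "of_int k / of_int m = (of_int k' / of_int m' :: 'k)" if "R a m' k'" for m' k'
    proof -
      have "m \<noteq> 0" "m' \<noteq> 0" using mk that unfolding R_def by auto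
      moreover have "of_int (m * k') = (of_int (m' * k) :: 'k)" using unique[OF mk that] by simp
      ultimately show ?thesis by (simp add: field_simps)
    qed
    then show "\<exists>y. \<forall>m k. R a m k \<longrightarrow> y = (of_int k / of_int m :: 'k)" by blast
  qed
  then obtain \<phi> where \<phi>: "\<And>a m k. R a m k \<Longrightarrow> \<phi> a = (of_int k / of_int m :: 'k)" by blast
  have "\<phi> (a + b) = \<phi> a + \<phi> b" for a b
  proof -
    obtain m k m' k' where R: "R a m k" "R b m' k'" using ex by metis
    then have nz: "m \<noteq> 0" "m' \<noteq> 0" unfolding R_def by auto
    \<comment> \<open>The two congruences are added over the common denominator
      \<open>m * m'\<close>.\<close>
    have "int_mult m' (int_mult m a - int_mult k \<delta>) + int_mult m (int_mult m' b - int_mult k' \<delta>) \<in> N"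
      using R subN unfolding R_def
      by (metis int_mult.subspace_add int_mult.subspace_scale)
    also have "int_mult m' (int_mult m a - int_mult k \<delta>) + int_mult m (int_mult m' b - int_mult k' \<delta>)
      = int_mult (m * m') (a + b) - int_mult (m' * k + m * k') \<delta>"
      by (simp add: int_mult.scale_right_diff_distrib int_mult.scale_left_distrib
          int_mult.scale_right_distrib mult.commute)
    finally have "R (a + b) (m * m') (m' * k + m * k')"
      using nz unfolding R_def by simp
    from \<phi>[OF this] \<phi>[OF R(1)] \<phi>[OF R(2)] nz show ?thesis by (simp add: add_divide_distrib add.commute)
  qed
  moreover have "R \<delta> 1 1"
    using int_mult.subspace_0[OF subN] unfolding R_def by simp
  then have "\<phi> \<delta> = 1" using \<phi> by fastforce
  ultimately show thesis using that by blast
qed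

section \<open>Direct sums: induction and diagonal maps\<close>

text \<open>Every vector is a finite sum of homogeneous ones, so identities additive in a variable
  need checking only on homogeneous elements.\<close>

lemma direct_sum_induct:
  assumes "direct_sum_decomposition scale V"
    and hom: "\<And>\<alpha> x. x \<in> V \<alpha> \<Longrightarrow> P x"
    and zero: "P 0" and add: "\<And>x y. P x \<Longrightarrow> P y \<Longrightarrow> P (x + y)"
  shows "P x"
proof -
  obtain c where c: "\<And>\<alpha>. c \<alpha> \<in> V \<alpha>" "finite {\<alpha>. c \<alpha> \<noteq> 0}" "x = (\<Sum>\<alpha> | c \<alpha> \<noteq> 0. c \<alpha>)"
    using assms(1) unfolding direct_sum_decomposition_def by metis
  have "P (\<Sum>\<alpha>\<in>S. c \<alpha>)" if "finite S" for S
    using that by induction (auto intro: zero add hom c(1))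
  with c(2,3) show ?thesis by simp
qed

text \<open>Uniqueness of the decomposition makes componentwise scaling well defined; linearity
  holds because componentwise sums and multiples of decompositions are again decompositions.\<close>

lemma direct_sum_diagonal_map:
  fixes \<phi> :: "'a \<Rightarrow> 'k::field"
  assumes "vector_space scale" and dec: "direct_sum_decomposition scale V"
  obtains D where "Vector_Spaces.linear scale scale D"
    and "\<And>\<alpha> x. x \<in> V \<alpha> \<Longrightarrow> D x = scale (\<phi> \<alpha>) x"
proof -
  interpret vector_space scale by fact
  have sub: "subspace (V \<alpha>)" for \<alpha>
    using dec unfolding direct_sum_decomposition_def by blast
  define dcp where "dcp x c \<longleftrightarrow>
    (\<forall>\<alpha>. c \<alpha> \<in> V \<alpha>) \<and> finite {\<alpha>. c \<alpha> \<noteq> 0} \<and> x = (\<Sum>\<alpha> | c \<alpha> \<noteq> 0. c \<alpha>)" for x c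
  have ex1: "\<exists>!c. dcp x c" for x
    using dec unfolding direct_sum_decomposition_def dcp_def by blast
  define D where "D x = (\<Sum>\<alpha> | (THE c. dcp x c) \<alpha> \<noteq> 0. scale (\<phi> \<alpha>) ((THE c. dcp x c) \<alpha>))" for x
  \<comment> \<open>Here and in \<open>D_eq\<close> any finite superset \<open>S\<close> of the
    support may index the sums. Supports can shrink under addition, or under scaling by 0, so a
    fixed index set is easier to handle.\<close>
  have dcpI: "dcp x c" if "\<And>\<alpha>. c \<alpha> \<in> V \<alpha>" "finite S" "{\<alpha>. c \<alpha> \<noteq> 0} \<subseteq> S" "x = sum c S" for x c S
    unfolding dcp_def
  proof (intro conjI)
    show "finite {\<alpha>. c \<alpha> \<noteq> 0}" using that finite_subset by blast
    show "x = (\<Sum>\<alpha> | c \<alpha> \<noteq> 0. c \<alpha>)"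
      unfolding that(4) by (rule sum.mono_neutral_right) (use that in auto)
  qed (use that in auto)
  have D_eq: "D x = (\<Sum>\<alpha>\<in>S. scale (\<phi> \<alpha>) (c \<alpha>))"
    if "dcp x c" "finite S" "{\<alpha>. c \<alpha> \<noteq> 0} \<subseteq> S" for x c S
  proof -
    have "(THE c. dcp x c) = c" by (rule the_equality) (use that(1) ex1[of x] in blast)+
    then show ?thesis
      unfolding D_def by simp (rule sum.mono_neutral_left, use that in auto)
  qed
  have "D (x + y) = D x + D y" for x y
  proof -
    obtain c d where cd: "dcp x c" "dcp y d" using ex1 by metis
    define S where "S = {\<alpha>. c \<alpha> \<noteq> 0} \<union> {\<alpha>. d \<alpha> \<noteq> 0}"
    have S: "finite S" using cd unfolding dcp_def S_def by auto
    have sums: "x = sum c S" "y = sum d S"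
      using cd S unfolding dcp_def S_def by (auto intro!: sum.mono_neutral_left)
    have "dcp (x + y) (\<lambda>\<alpha>. c \<alpha> + d \<alpha>)"
    proof (rule dcpI[OF _ S])
      show "c \<alpha> + d \<alpha> \<in> V \<alpha>" for \<alpha>
        using cd sub subspace_add unfolding dcp_def by blast
    qed (auto simp: S_def sums sum.distrib[symmetric])
    moreover have "{\<alpha>. c \<alpha> \<noteq> 0} \<subseteq> S" "{\<alpha>. d \<alpha> \<noteq> 0} \<subseteq> S" "{\<alpha>. c \<alpha> + d \<alpha> \<noteq> 0} \<subseteq> S"
      unfolding S_def by auto
    ultimately show ?thesis
      using D_eq[OF _ S] cd by (simp add: scale_right_distrib sum.distrib)
  qed
  moreover have "D (scale r x) = scale r (D x)" for r x
  proof -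
    obtain c where c: "dcp x c" using ex1 by metis
    define S where "S = {\<alpha>. c \<alpha> \<noteq> 0}"
    have S: "finite S" and x: "x = sum c S" using c unfolding dcp_def S_def by auto
    have "dcp (scale r x) (\<lambda>\<alpha>. scale r (c \<alpha>))"
    proof (rule dcpI[OF _ S])
      show "scale r (c \<alpha>) \<in> V \<alpha>" for \<alpha>
        using c sub subspace_scale unfolding dcp_def by blast
    qed (auto simp: S_def x scale_sum_right)
    from D_eq[OF this S] D_eq[OF c S] show ?thesis
      by (auto simp: S_def scale_sum_right mult.commute)
  qed
  ultimately have "Vector_Spaces.linear scale scale D"
    unfolding Vector_Spaces.linear_iff using \<open>vector_space scale\<close> by blast
  moreover have "D x = scale (\<phi> \<alpha>) x" if "x \<in> V \<alpha>" for \<alpha> x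
  proof -
    \<comment> \<open>A homogeneous vector is its own only component; the index set
      \<open>{\<alpha>}\<close> also covers \<open>x = 0\<close>.\<close>
    have "dcp x (\<lambda>\<beta>. if \<beta> = \<alpha> then x else 0)"
      by (rule dcpI[of _ "{\<alpha>}"]) (use that sub subspace_0 in auto)
    moreover have "{\<beta>. (if \<beta> = \<alpha> then x else 0) \<noteq> 0} \<subseteq> {\<alpha>}"
      by auto
    ultimately show ?thesis
      using D_eq[of x "\<lambda>\<beta>. if \<beta> = \<alpha> then x else 0" "{\<alpha>}"] by simp
  qed
  ultimately show thesis using that by blast
qed

section \<open>The derivation defined by the grading\<close>

theorem corollary1p3:
  fixes scale :: "'k::field_char_0 \<Rightarrow> 'g::ab_group_add \<Rightarrow> 'g"
    and bracket :: "'g \<Rightarrow> 'g \<Rightarrow> 'g"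
    and B :: "'g \<Rightarrow> 'g \<Rightarrow> 'k"
    and V :: "'a::ab_group_add \<Rightarrow> 'g set"
    and \<delta> :: 'a
  assumes "lie_algebra scale bracket"
    and "bilinear_form scale B"
    and "symmetric_form B"
    and "invariant_form bracket B"
    and "torsion_free_group TYPE('a)"
    and "lie_grading scale bracket V"
    and "homogeneous_form V B \<delta>"
    and "\<delta> \<noteq> 0"
  shows "exact_3form scale bracket (J_form bracket B)"
proof -
  interpret lie_algebra scale bracket by fact
  have dec: "direct_sum_decomposition scale V"
    and grad: "\<And>\<alpha> \<beta> x y. x \<in> V \<alpha> \<Longrightarrow> y \<in> V \<beta> \<Longrightarrow> bracket x y \<in> V (\<alpha> + \<beta>)"
    using assms(6) unfolding lie_grading_def by auto
  obtain \<phi> :: "'a \<Rightarrow> 'k" where \<phi>: "\<And>a b. \<phi> (a + b) = \<phi> a + \<phi> b" "\<phi> \<delta> = 1"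
    using torsion_free_additive_map[OF assms(5,8)] by blast
  obtain D where linD: "Vector_Spaces.linear scale scale D"
    and D: "\<And>\<alpha> x. x \<in> V \<alpha> \<Longrightarrow> D x = scale (\<phi> \<alpha>) x"
    using direct_sum_diagonal_map[OF vector_space_axioms dec] by blast
  have D_add: "D (x + y) = D x + D y" for x y
    using linD unfolding Vector_Spaces.linear_iff by blast
  have br: "bracket (x + y) z = bracket x z + bracket y z" "bracket x (y + z) = bracket x y + bracket x z"
    "bracket (scale c x) y = scale c (bracket x y)" "bracket x (scale c y) = scale c (bracket x y)" for x y z c
    using bilinear_bracket unfolding bilinear_map_iff by auto
  have B: "B (x + y) z = B x z + B y z" "B x (y + z) = B x y + B x z"
    "B (scale c x) y = c * B x y" "B x (scale c y) = c * B x y" for x y z c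
    using assms(2) unfolding bilinear_form_def bilinear_map_iff by auto
  have zero: "D 0 = 0" "bracket 0 x = 0" "bracket x 0 = 0" "B 0 x = 0" "B x 0 = 0" for x
    using D_add[of 0 0] br(1)[of 0 0 x] br(2)[of x 0 0] B(1)[of 0 0 x] B(2)[of x 0 0] by simp_all
  have "D (bracket x y) = bracket (D x) y + bracket x (D y)" for x y
  proof (induction x rule: direct_sum_induct[OF dec])
    case (1 \<alpha> x)
    show ?case
    proof (induction y rule: direct_sum_induct[OF dec])
      case (1 \<beta> y)
      \<comment> \<open>The bracket has degree \<open>\<alpha> + \<beta>\<close>, so the Leibniz
        rule is additivity of \<open>\<phi>\<close>.\<close>
      with \<open>x \<in> V \<alpha>\<close> show ?case by (simp add: D[OF grad] D \<phi> br scale_left_distrib)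
    qed (simp_all add: zero br D_add)
  qed (simp_all add: zero br D_add)
  moreover have "B (D x) y + B x (D y) = - 1 * B x y" for x y
  proof (induction x rule: direct_sum_induct[OF dec])
    case (1 \<alpha> x)
    show ?case
    proof (induction y rule: direct_sum_induct[OF dec])
      case (1 \<beta> y)
      show ?case
      \<comment> \<open>Either the degrees sum to \<open>- \<delta>\<close>, and then
        \<open>\<phi> \<alpha> + \<phi> \<beta> = - \<phi> \<delta> = - 1\<close>, or homogeneity
        makes both sides vanish.\<close>
      proof (cases "\<alpha> + \<beta> + \<delta> = 0")
        case True
        have "\<phi> 0 = 0" using \<phi>(1)[of 0 0] by simp
        then have "\<phi> \<alpha> + \<phi> \<beta> = - 1"
          using \<phi>(1)[of "\<alpha> + \<beta>" \<delta>] True by (simp add: \<phi> eq_neg_iff_add_eq_0)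
        then show ?thesis
          using \<open>x \<in> V \<alpha>\<close> 1 by (simp only: D B distrib_right[symmetric])
      next
        case False
        then show ?thesis
          using assms(7) \<open>x \<in> V \<alpha>\<close> 1 unfolding homogeneous_form_def by (simp add: D B)
      qed
    qed (simp_all add: zero B D_add algebra_simps)
  qed (simp_all add: zero B D_add algebra_simps)
  ultimately show ?thesis
    by (intro exact_3form_of_derivation[OF assms(1-4) linD, where l = "- 1"]) auto
qed

end
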